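(* For a matroid $M$ and nonnegative integers $k,s,c$ with $k\le r(M)$, let $f_k(s,c)$ be the number of rank-$k$ flats $X$ of $M$ of size $s$ such that the restriction $M|X$ has exactly $c$ coloops. The number $f_k(s,c)$ is derivable from the $\mathcal{G}$-invariant of $M$; that is, if $M$ and $M'$ are matroids with $\mathcal{G}(M)=\mathcal{G}(M')$, then the numbers $f_k(s,c)$ for $M$ and for $M'$ are equal for all $k,s,c$.
   Context: $\mathcal{G}(n,r)$ is the vector space over a field of characteristic zero with basis the formal symbols $[\underline{r}]$, one for each $0,1$-sequence of length $n$ with exactly $r$ ones. For a rank-$r$ matroid $M$ with rank function $r(\cdot)$ on an $n$-element set $E$ and a permutation (linear ordering) $\pi$ of $E$, the rank sequence $\underline{r}(\pi)=r_1\ldots r_n$ has $r_1=r(\{\pi(1)\})$ and $r_j=r(\{\pi(1),\ldots,\pi(j)\})-r(\{\pi(1),\ldots,\pi(j-1)\})$ for $j\ge2$. The $\mathcal{G}$-invariant is $\mathcal{G}(M)=\sum_\pi[\underline{r}(\pi)]\in\mathcal{G}(n,r)$, over all $n!$ permutations of $E$. (Note that $f_k(s,0)$ is the number of cyclic flats, i.e. flats $X$ with $M|X$ coloop-free, of rank $k$ and size $s$.) *)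

theory Defs
  imports "HOL-Library.Poly_Mapping" "HOL-Combinatorics.Multiset_Permutations"
begin

locale matroid =
  fixes E :: "'a set" and indep :: "'a set \<Rightarrow> bool"
  assumes finite_ground: "finite E"
    and indep_subset_ground: "indep X \<Longrightarrow> X \<subseteq> E"
    and indep_empty: "indep {}"
    and indep_subset: "indep X \<Longrightarrow> Y \<subseteq> X \<Longrightarrow> indep Y"
    and indep_augment: "indep X \<Longrightarrow> indep Y \<Longrightarrow> card X < card Y \<Longrightarrow> \<exists>y\<in>Y - X. indep (insert y X)"

definition rank_of :: "('a set \<Rightarrow> bool) \<Rightarrow> 'a set \<Rightarrow> nat" where
  "rank_of indep X = Max {card I | I. I \<subseteq> X \<and> indep I}"

definition basis :: "'a set \<Rightarrow> ('a set \<Rightarrow> bool) \<Rightarrow> 'a set \<Rightarrow> bool" where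
  "basis E indep B \<longleftrightarrow> B \<subseteq> E \<and> indep B \<and> (\<forall>x\<in>E - B. \<not> indep (insert x B))"

definition coloops :: "'a set \<Rightarrow> ('a set \<Rightarrow> bool) \<Rightarrow> 'a set" where
  "coloops E indep = {e \<in> E. \<forall>B. basis E indep B \<longrightarrow> e \<in> B}"

definition restr :: "('a set \<Rightarrow> bool) \<Rightarrow> 'a set \<Rightarrow> 'a set \<Rightarrow> bool" where
  "restr indep X = (\<lambda>I. I \<subseteq> X \<and> indep I)"

definition flat :: "'a set \<Rightarrow> ('a set \<Rightarrow> bool) \<Rightarrow> 'a set \<Rightarrow> bool" where
  "flat E indep X \<longleftrightarrow> X \<subseteq> E \<and> (\<forall>x\<in>E - X. rank_of indep X < rank_of indep (insert x X))"

definition num_flats :: "'a set \<Rightarrow> ('a set \<Rightarrow> bool) \<Rightarrow> nat \<Rightarrow> nat \<Rightarrow> nat \<Rightarrow> nat" where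
  "num_flats E indep k s c =
     card {X. flat E indep X \<and> rank_of indep X = k \<and> card X = s \<and>
              card (coloops X (restr indep X)) = c}"

text \<open>A linear ordering of the ground set is a duplicate-free list enumerating it.
  Positions are counted from 0, and the first entry is the rank of a singleton,
  since the empty set has rank 0.\<close>

definition rank_sequence :: "('a set \<Rightarrow> bool) \<Rightarrow> 'a list \<Rightarrow> nat list" where
  "rank_sequence indep p =
     map (\<lambda>j. rank_of indep (set (take (Suc j) p)) - rank_of indep (set (take j p))) [0..<length p]"

text \<open>The spaces \<open>\<G>(n,r)\<close> are realised inside the single space of finitely supported functions
  on sequences, the symbol of a sequence \<open>s\<close> being \<open>Poly_Mapping.single s 1\<close>.  Spaces for distinct
  \<open>(n,r)\<close> meet only in 0, so no parameter needs to be carried along.\<close>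

definition G_space :: "nat \<Rightarrow> nat \<Rightarrow> (nat list \<Rightarrow>\<^sub>0 'k::field_char_0) set" where
  "G_space n r = {v. \<forall>s\<in>Poly_Mapping.keys v. length s = n \<and> set s \<subseteq> {0, 1} \<and> count_list s 1 = r}"

definition G_invariant :: "'a set \<Rightarrow> ('a set \<Rightarrow> bool) \<Rightarrow> (nat list \<Rightarrow>\<^sub>0 'k::field_char_0)" where
  "G_invariant E indep =
     (\<Sum>p\<in>permutations_of_set E. Poly_Mapping.single (rank_sequence indep p) 1)"

context matroid
begin

lemma matroid_restr: "X \<subseteq> E \<Longrightarrow> matroid X (restr indep X)"
proof
  fix Y Z assume "restr indep X Y" "restr indep X Z" "card Y < card Z"
  then show "\<exists>y\<in>Z - Y. restr indep X (insert y Y)"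
    using indep_augment[of Y Z] by (auto simp: restr_def)
qed (use finite_ground indep_empty indep_subset in \<open>auto simp: restr_def intro: finite_subset\<close>)

lemma finite_rank_set: "finite {card I | I. I \<subseteq> X \<and> indep I}"
proof -
  have "{card I | I. I \<subseteq> X \<and> indep I} \<subseteq> card ` Pow E"
    using indep_subset_ground by auto
  then show ?thesis using finite_ground by (meson finite_Pow_iff finite_imageI finite_subset)
qed

lemma card_le_rank: "I \<subseteq> X \<Longrightarrow> indep I \<Longrightarrow> card I \<le> rank_of indep X"
  unfolding rank_of_def by (rule Max_ge[OF finite_rank_set]) auto

lemma rank_attained: "\<exists>I. I \<subseteq> X \<and> indep I \<and> card I = rank_of indep X"
proof -
  have "{card I | I. I \<subseteq> X \<and> indep I} \<noteq> {}" using indep_empty by blast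
  from Max_in[OF finite_rank_set this] show ?thesis unfolding rank_of_def by auto
qed

lemma rank_empty: "rank_of indep {} = 0"
  using rank_attained[of "{}"] by auto

lemma rank_mono: "X \<subseteq> Y \<Longrightarrow> rank_of indep X \<le> rank_of indep Y"
  using rank_attained[of X] card_le_rank[of _ Y] by (metis subset_trans)

lemma rank_insert_le: "rank_of indep (insert x X) \<le> Suc (rank_of indep X)"
proof -
  obtain I where I: "I \<subseteq> insert x X" "indep I" "card I = rank_of indep (insert x X)"
    using rank_attained by blast
  have fin: "finite I" using I(2) finite_ground indep_subset_ground finite_subset by blast
  have "card (I - {x}) \<le> rank_of indep X"
    using I indep_subset[of I "I - {x}"] by (intro card_le_rank) auto
  moreover have "card I \<le> Suc (card (I - {x}))" using fin by (auto simp: card_Diff_singleton_if)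
  ultimately show ?thesis using I(3) by simp
qed

lemma rank_sequence_snoc:
  "rank_sequence indep (p @ [x]) =
     rank_sequence indep p @ [rank_of indep (insert x (set p)) - rank_of indep (set p)]"
  unfolding rank_sequence_def by auto

lemma rank_sequence_binary:
  "set (rank_sequence indep p) \<subseteq> {0, 1} \<and>
   count_list (rank_sequence indep p) 1 = rank_of indep (set p)"
proof (induction p rule: rev_induct)
  case Nil
  then show ?case by (simp add: rank_sequence_def rank_empty)
next
  case (snoc x p)
  have "rank_of indep (insert x (set p)) = rank_of indep (set p) \<or>
        rank_of indep (insert x (set p)) = Suc (rank_of indep (set p))"
    using rank_insert_le[of x "set p"] rank_mono[OF subset_insertI, of "set p" x] by linarith
  then show ?case using snoc by (auto simp: rank_sequence_snoc)
qed

lemma G_invariant_in_G_space: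
  "(G_invariant E indep :: nat list \<Rightarrow>\<^sub>0 'k::field_char_0) \<in> G_space (card E) (rank_of indep E)"
  unfolding G_space_def
proof (intro CollectI ballI)
  fix s assume "s \<in> Poly_Mapping.keys (G_invariant E indep :: nat list \<Rightarrow>\<^sub>0 'k)"
  then obtain p where p: "p \<in> permutations_of_set E"
    "s \<in> Poly_Mapping.keys (Poly_Mapping.single (rank_sequence indep p) (1::'k))"
    unfolding G_invariant_def using keys_sum by (metis (no_types, lifting) UN_E subsetD)
  then have s: "s = rank_sequence indep p" by simp
  have "set p = E" "length p = card E"
    using p(1) by (auto simp: permutations_of_set_def distinct_card)
  then show "length s = card E \<and> set s \<subseteq> {0, 1} \<and> count_list s 1 = rank_of indep E"
    using rank_sequence_binary[of p] by (simp add: s rank_sequence_def)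
qed

end

end

theory Submission
  imports Defs
begin

text \<open>
  For a set \<open>A\<close> of size \<open>s\<close> let \<open>c(A)\<close> be the number of coloops of \<open>M|A\<close> and \<open>d(A) = |cl(A) - A|\<close>,
  so that \<open>A\<close> is a flat iff \<open>d(A) = 0\<close>. In an ordering that starts with \<open>A\<close>, the last \<open>j\<close>
  elements of \<open>A\<close> contribute only ones iff they are coloops of \<open>M|A\<close>, and the \<open>m\<close> elements after
  \<open>A\<close> contribute only zeros iff they lie in \<open>cl(A)\<close>. Counting the orderings whose rank sequence has
  \<open>k\<close> ones among its first \<open>s\<close> entries, only ones in the positions \<open>s-j+1, \<dots>, s\<close> and only zeros in
  the positions \<open>s+1, \<dots>, s+m\<close> therefore yields, up to a factorial factor, the joint binomial moment
  \<open>\<Sum>\<^sub>A (c(A) choose j) (d(A) choose m)\<close> over the sets \<open>A\<close> of size \<open>s\<close> and rank \<open>k\<close>.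
  Binomial inversion recovers the number of \<open>A\<close> with \<open>c(A) = c\<close> and \<open>d(A) = 0\<close>.
\<close>

section \<open>Permutations with prescribed first or last entries\<close>

lemma card_permutations_take_subset:
  assumes "finite S" "D \<subseteq> S" "m \<le> card S"
  shows "card {p \<in> permutations_of_set S. set (take m p) \<subseteq> D} =
    (card D choose m) * fact m * fact (card S - m)"
  using assms
proof (induction m arbitrary: S D)
  case 0
  then show ?case by simp
next
  case (Suc m)
  have finD: "finite D" using Suc.prems finite_subset by blast
  have ne: "S \<noteq> {}" using Suc.prems by auto
  let ?P = "\<lambda>x. {p \<in> permutations_of_set (S - {x}). set (take m p) \<subseteq> D - {x}}"
  \<comment> \<open>Peel off the first entry \<open>x\<close>, which must lie in \<open>D\<close>:
    the rest is a permutation of \<open>S - {x}\<close> whose first \<open>m\<close> entries lie in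
    \<open>D - {x}\<close>. The union over \<open>x\<close> is disjoint.\<close>
  have eq: "{p \<in> permutations_of_set S. set (take (Suc m) p) \<subseteq> D} = (\<Union>x\<in>D. (#) x ` ?P x)"
    (is "?L = ?R")
  proof
    show "?L \<subseteq> ?R"
    proof
      fix p assume p: "p \<in> ?L"
      then obtain x q where q: "x \<in> S" "q \<in> permutations_of_set (S - {x})" "p = x # q"
        using permutations_of_set_nonempty[OF ne] by auto
      then have "x \<notin> set (take m q)"
        by (auto simp: permutations_of_set_def dest: in_set_takeD)
      with p q show "p \<in> ?R" by auto
    qed
    show "?R \<subseteq> ?L"
      using Suc.prems(2) permutations_of_set_nonempty[OF ne] by auto
  qed
  have "card ?L = (\<Sum>x\<in>D. card ((#) x ` ?P x))"
    unfolding eq using finD by (intro card_UN_disjoint) auto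
  also have "\<dots> = (\<Sum>x\<in>D. card (?P x))"
    by (intro sum.cong card_image) auto
  also have "\<dots> = (\<Sum>x\<in>D. (card D - 1 choose m) * fact m * fact (card S - Suc m))"
  proof (intro sum.cong refl)
    fix x assume x: "x \<in> D"
    then have "card (S - {x}) = card S - 1" "card (D - {x}) = card D - 1"
      using Suc.prems(2) by auto
    then show "card (?P x) = (card D - 1 choose m) * fact m * fact (card S - Suc m)"
      using Suc.IH[of "S - {x}" "D - {x}"] Suc.prems Diff_mono[OF Suc.prems(2), of "{x}" "{x}"]
      by auto
  qed
  also have "\<dots> = card D * (card D - 1 choose m) * fact m * fact (card S - Suc m)"
    by simp
  also have "card D * (card D - 1 choose m) = Suc m * (card D choose Suc m)"
    using Suc_times_binomial_eq[of "card D - 1" m]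
    by (cases "card D") (simp_all del: binomial_Suc_Suc mult_Suc add: mult.commute)
  finally show ?case by (simp add: algebra_simps)
qed

text \<open>Reversal turns a condition on the last \<open>j\<close> entries into one on the first
  \<open>j\<close>.\<close>

lemma card_permutations_drop_subset:
  assumes "finite S" "D \<subseteq> S" "j \<le> card S"
  shows "card {p \<in> permutations_of_set S. set (drop (card S - j) p) \<subseteq> D} =
    (card D choose j) * fact j * fact (card S - j)"
proof -
  have "{p \<in> permutations_of_set S. set (drop (card S - j) p) \<subseteq> D} =
    rev ` {p \<in> permutations_of_set S. set (take j p) \<subseteq> D}" (is "?L = rev ` ?R")
  proof (intro equalityI subsetI)
    fix p assume p: "p \<in> ?L"
    then have "length p = card S" by (auto simp: permutations_of_set_def distinct_card)
    with p assms(3) have "rev p \<in> ?R"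
      by (auto simp: permutations_of_set_def take_rev)
    then show "p \<in> rev ` ?R" by (metis image_eqI rev_rev_ident)
  next
    fix p assume "p \<in> rev ` ?R"
    then obtain q where q: "p = rev q" "q \<in> ?R" by auto
    then have "length q = card S" by (auto simp: permutations_of_set_def distinct_card)
    with q assms(3) show "p \<in> ?L"
      by (auto simp: permutations_of_set_def drop_rev)
  qed
  then have "card ?L = card ?R" by (simp add: card_image)
  with card_permutations_take_subset[OF assms] show ?thesis by simp
qed

text \<open>Cutting after \<open>s\<close> entries is a bijection onto the triples formed by an
  \<open>s\<close>-subset \<open>A\<close>, an ordering of \<open>A\<close> and an ordering of
  \<open>E - A\<close>. Keeping \<open>P\<close> arbitrary allows the two halves to be analysed
  later for each fixed \<open>A\<close>.\<close>

lemma permutations_of_set_split: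
  assumes "finite E" "s \<le> card E"
  shows "card {p \<in> permutations_of_set E. P (take s p) (drop s p)} =
    (\<Sum>A | A \<subseteq> E \<and> card A = s.
      card {(p, q). p \<in> permutations_of_set A \<and> q \<in> permutations_of_set (E - A) \<and> P p q})"
    (is "card ?L = (\<Sum>A | _. card (?S A))")
proof -
  let ?f = "\<lambda>p. (take s p, drop s p)"
  have inj: "inj_on ?f ?L" by (metis (lifting) append_take_drop_id inj_onI prod.inject)
  have "?f ` ?L = (\<Union>A\<in>{A. A \<subseteq> E \<and> card A = s}. ?S A)"
  proof (intro equalityI subsetI)
    fix z assume "z \<in> ?f ` ?L"
    then obtain p where p: "p \<in> permutations_of_set E" "P (take s p) (drop s p)" "z = ?f p"
      by auto
    then have sp: "set p = E" "distinct p" "length p = card E"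
      by (auto simp: permutations_of_set_def distinct_card)
    have disj: "set (take s p) \<inter> set (drop s p) = {}"
      using sp(2) set_take_disj_set_drop_if_distinct by blast
    have "set (take s p) \<union> set (drop s p) = E"
      using sp(1) by (metis append_take_drop_id set_append)
    with disj have "set (drop s p) = E - set (take s p)" by auto
    moreover have "card (set (take s p)) = s"
      using sp assms(2) by (simp add: distinct_card)
    moreover have "set (take s p) \<subseteq> E" using sp(1) set_take_subset by metis
    ultimately show "z \<in> (\<Union>A\<in>{A. A \<subseteq> E \<and> card A = s}. ?S A)"
      using p sp(2) by (auto simp: permutations_of_set_def)
  next
    fix z assume "z \<in> (\<Union>A\<in>{A. A \<subseteq> E \<and> card A = s}. ?S A)"
    then obtain A p q where *: "A \<subseteq> E" "card A = s" "p \<in> permutations_of_set A"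
      "q \<in> permutations_of_set (E - A)" "P p q" "z = (p, q)" by auto
    then have "length p = s" by (auto simp: permutations_of_set_def distinct_card)
    with * have "z = ?f (p @ q)" "p @ q \<in> ?L"
      by (auto simp: permutations_of_set_def)
    then show "z \<in> ?f ` ?L" by blast
  qed
  then have "card ?L = card (\<Union>A\<in>{A. A \<subseteq> E \<and> card A = s}. ?S A)"
    using card_image[OF inj] by simp
  also have "\<dots> = (\<Sum>A | A \<subseteq> E \<and> card A = s. card (?S A))"
  proof (rule card_UN_disjoint)
    show "finite {A. A \<subseteq> E \<and> card A = s}" using assms(1) by simp
    show "\<forall>A\<in>{A. A \<subseteq> E \<and> card A = s}. finite (?S A)"
    proof
      fix A
      have "?S A \<subseteq> permutations_of_set A \<times> permutations_of_set (E - A)" by auto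
      then show "finite (?S A)" by (rule finite_subset) simp
    qed
  qed (auto simp: permutations_of_set_def)
  finally show ?thesis .
qed

section \<open>Binomial inversion\<close>

lemma alternating_binomial_delta:
  assumes "n \<le> N"
  shows "(\<Sum>j\<le>N. (- 1) ^ j * int (n choose j)) = (if n = 0 then 1 else 0)"
proof -
  have "(\<Sum>j\<le>N. (- 1) ^ j * int (n choose j)) = (\<Sum>j\<le>n. (- 1) ^ j * int (n choose j))"
    using assms by (intro sum.mono_neutral_right) auto
  also have "\<dots> = (if n = 0 then 1 else 0)"
    using choose_alternating_sum[of n, where ?'a = int] by (cases "n = 0") auto
  finally show ?thesis .
qed

text \<open>Since (n choose j)(j choose c) = (n choose c)(n-c choose j-c), a factor free of
  \<open>j\<close> comes out and the alternating row sum for \<open>n - c\<close> remains. The sign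
  uses \<open>j + c\<close>, of the same parity as the difference, to avoid truncated subtraction.
  The free bound \<open>N\<close> lets one summation range serve all values of \<open>n\<close> at
  once.\<close>

lemma binomial_inversion_delta:
  assumes "n \<le> N"
  shows "(\<Sum>j\<le>N. (- 1) ^ (j + c) * int (j choose c) * int (n choose j)) =
    (if n = c then 1 else 0)"
proof (cases "c \<le> n")
  case False
  then have "(\<Sum>j\<le>N. (- 1) ^ (j + c) * int (j choose c) * int (n choose j)) = 0"
    by (intro sum.neutral) (auto simp: binomial_eq_0 not_le)
  with False show ?thesis by simp
next
  case True
  have "(\<Sum>j\<le>N. (- 1) ^ (j + c) * int (j choose c) * int (n choose j)) =
    (\<Sum>j\<in>{c..N}. (- 1) ^ (j + c) * int (j choose c) * int (n choose j))"
    by (intro sum.mono_neutral_right) (auto simp: binomial_eq_0)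
  also have "\<dots> = (\<Sum>i\<le>N - c. (- 1) ^ i * int (n - c choose i) * int (n choose c))"
  proof (rule sum.reindex_bij_witness[where i = "\<lambda>i. i + c" and j = "\<lambda>j. j - c"])
    fix j assume j: "j \<in> {c..N}"
    have "(n choose j) * (j choose c) = (n choose c) * (n - c choose (j - c))"
      using j True by (cases "j \<le> n") (simp_all add: choose_mult binomial_eq_0)
    then have "int (j choose c) * int (n choose j) = int (n - c choose (j - c)) * int (n choose c)"
      by (metis mult.commute of_nat_mult)
    moreover have "(- 1 :: int) ^ (j + c) = (- 1) ^ (j - c)"
      using j by (simp add: uminus_power_if)
    ultimately show "(- 1) ^ (j - c) * int (n - c choose (j - c)) * int (n choose c) =
        (- 1) ^ (j + c) * int (j choose c) * int (n choose j)"
      by (simp add: mult.assoc)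
  qed (use True assms in auto)
  also have "\<dots> = (\<Sum>i\<le>N - c. (- 1) ^ i * int (n - c choose i)) * int (n choose c)"
    by (simp add: sum_distrib_right)
  also have "\<dots> = (if n = c then 1 else 0)"
    using True assms by (subst alternating_binomial_delta) auto
  finally show ?thesis .
qed

section \<open>Statistics of rank sequences determined by the invariant\<close>

lemma G_invariant_determines_counts:
  fixes indep :: "'a set \<Rightarrow> bool" and indep' :: "'b set \<Rightarrow> bool"
  assumes "(G_invariant E indep :: nat list \<Rightarrow>\<^sub>0 'k::field_char_0) = G_invariant E' indep'"
  shows "card {p \<in> permutations_of_set E. Q (rank_sequence indep p)} =
    card {p \<in> permutations_of_set E'. Q (rank_sequence indep' p)}"
proof -
  \<comment> \<open>The coefficient at \<open>r\<close> is the number of orderings with rank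
    sequence \<open>r\<close>. In characteristic zero this number can be read off from the field
    element, so the invariant determines the whole multiset of rank sequences.\<close>
  have lookup: "Poly_Mapping.lookup (G_invariant F ind :: nat list \<Rightarrow>\<^sub>0 'k) r =
      of_nat (count (image_mset (rank_sequence ind) (mset_set (permutations_of_set F))) r)"
    for F :: "'c set" and ind r
  proof -
    have "Poly_Mapping.lookup (G_invariant F ind :: nat list \<Rightarrow>\<^sub>0 'k) r =
        of_nat (card {p \<in> permutations_of_set F. r = rank_sequence ind p})"
      unfolding G_invariant_def lookup_sum
      by (simp add: lookup_single when_def sum.If_cases Int_def eq_commute)
    then show ?thesis
      by (simp add: count_image_mset' sum.If_cases Int_def flip: sum.inter_filter)
  qed
  have "image_mset (rank_sequence indep) (mset_set (permutations_of_set E)) =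
    image_mset (rank_sequence indep') (mset_set (permutations_of_set E'))"
    using lookup[of E indep] lookup[of E' indep'] assms by (intro multiset_eqI) (metis of_nat_eq_iff)
  then have "size (filter_mset Q (image_mset (rank_sequence indep) (mset_set (permutations_of_set E)))) =
    size (filter_mset Q (image_mset (rank_sequence indep') (mset_set (permutations_of_set E'))))"
    by simp
  then show ?thesis by (simp add: filter_mset_image_mset)
qed

section \<open>Coloops and closure in terms of rank\<close>

context matroid
begin

definition num_coloops :: "'a set \<Rightarrow> nat" where
  "num_coloops A = card (coloops A (restr indep A))"

text \<open>This is cl(A) - A, expressed by ranks so that no closure operator has to be
  introduced.\<close>

definition cl_diff :: "'a set \<Rightarrow> 'a set" where
  "cl_diff A = {x \<in> E - A. rank_of indep (insert x A) = rank_of indep A}"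

lemma finite_indep: "indep I \<Longrightarrow> finite I"
  using finite_ground indep_subset_ground finite_subset by blast

text \<open>A maximal independent subset of \<open>A\<close> smaller than the rank could be
  augmented from an independent subset of full size, so maximality and maximum size agree.\<close>

lemma basis_restr_iff:
  "basis A (restr indep A) B \<longleftrightarrow> B \<subseteq> A \<and> indep B \<and> card B = rank_of indep A"
proof
  assume B: "basis A (restr indep A) B"
  then have B': "B \<subseteq> A" "indep B" by (auto simp: basis_def restr_def)
  obtain I where I: "I \<subseteq> A" "indep I" "card I = rank_of indep A"
    using rank_attained by blast
  have "\<not> card B < card I"
    using indep_augment[OF B'(2) I(2)] B B' I(1) unfolding basis_def restr_def by blast
  then show "B \<subseteq> A \<and> indep B \<and> card B = rank_of indep A"
    using B' card_le_rank[of B A] I(3) by auto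
next
  assume B: "B \<subseteq> A \<and> indep B \<and> card B = rank_of indep A"
  have "\<not> indep (insert x B)" if "x \<in> A - B" for x
    using that B card_le_rank[of "insert x B" A] finite_indep[of B] by auto
  with B show "basis A (restr indep A) B" by (auto simp: basis_def restr_def)
qed

lemma indep_extends_to_basis:
  assumes "indep J" "J \<subseteq> F" "finite F"
  obtains B where "J \<subseteq> B" "basis F (restr indep F) B"
proof -
  let ?\<B> = "{B. B \<subseteq> F \<and> indep B}"
  obtain B where B: "B \<in> ?\<B>" "J \<subseteq> B" "\<forall>C\<in>?\<B>. B \<subseteq> C \<longrightarrow> B = C"
    using finite_has_maximal2[of ?\<B> J] assms by auto
  have "\<not> indep (insert x B)" if "x \<in> F - B" for x
    using that B(1) B(3)[rule_format, of "insert x B"] by auto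
  with B(1) have "basis F (restr indep F) B" by (simp add: basis_def restr_def)
  with B(2) show thesis by (rule that)
qed

lemma rank_union_le: "finite B \<Longrightarrow> rank_of indep (A \<union> B) \<le> rank_of indep A + card B"
proof (induction B rule: finite_induct)
  case (insert x B)
  then show ?case using rank_insert_le[of x "A \<union> B"] by simp
qed simp

text \<open>If the rank drops by the full number of deleted elements, then deleting any single one
  of them already lowers it, so no basis of \<open>F\<close> avoids that element. Conversely, a
  maximum independent subset of \<open>G\<close> extends to a basis of \<open>F\<close>, and this
  basis must contain all the coloops in \<open>F - G\<close>.\<close>

lemma rank_drop_iff_coloops:
  assumes "finite F" "G \<subseteq> F"
  shows "rank_of indep G + card (F - G) = rank_of indep F \<longleftrightarrow> F - G \<subseteq> coloops F (restr indep F)"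
proof
  assume eq: "rank_of indep G + card (F - G) = rank_of indep F"
  show "F - G \<subseteq> coloops F (restr indep F)"
  proof
    fix e assume e: "e \<in> F - G"
    then have "F - {e} = G \<union> (F - G - {e})" using assms(2) by auto
    then have "rank_of indep (F - {e}) \<le> rank_of indep G + card (F - G - {e})"
      using rank_union_le[of "F - G - {e}" G] assms(1) by simp
    also have "\<dots> < rank_of indep F"
      using card_Diff1_less[OF _ e] assms(1) unfolding eq[symmetric] by simp
    finally have less: "rank_of indep (F - {e}) < rank_of indep F" .
    have "e \<in> B" if "basis F (restr indep F) B" for B
    proof (rule ccontr)
      assume "e \<notin> B"
      then have "card B \<le> rank_of indep (F - {e})"
        using that by (intro card_le_rank) (auto simp: basis_restr_iff)
      with that less show False by (simp add: basis_restr_iff)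
    qed
    with e show "e \<in> coloops F (restr indep F)" by (auto simp: coloops_def)
  qed
next
  assume sub: "F - G \<subseteq> coloops F (restr indep F)"
  obtain J where J: "J \<subseteq> G" "indep J" "card J = rank_of indep G"
    using rank_attained by blast
  obtain B where B: "J \<subseteq> B" "basis F (restr indep F) B"
    using indep_extends_to_basis[of J F] J assms by blast
  then have B': "B \<subseteq> F" "indep B" "card B = rank_of indep F" by (simp_all add: basis_restr_iff)
  have "J \<union> (F - G) \<subseteq> B" using sub B by (auto simp: coloops_def)
  then have "card (J \<union> (F - G)) \<le> rank_of indep F"
    using card_mono[OF finite_indep[OF B'(2)]] B'(3) by metis
  moreover have "card (J \<union> (F - G)) = rank_of indep G + card (F - G)"
    using card_Un_disjoint[of J "F - G"] finite_indep[OF J(2)] J assms(1) by auto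
  moreover have "rank_of indep F \<le> rank_of indep G + card (F - G)"
    using rank_union_le[of "F - G" G] assms by (simp add: Un_absorb1)
  ultimately show "rank_of indep G + card (F - G) = rank_of indep F"
    by simp
qed

text \<open>Were the rank to grow only when all of \<open>B\<close> is added, augmentation would
  still enlarge a maximum independent \<open>I\<close> inside \<open>A\<close> by a single
  \<open>y\<close> of \<open>A\<close> or \<open>cl_diff A\<close>, contradicting that
  \<open>y\<close> alone leaves the rank of \<open>A\<close> unchanged.\<close>

lemma rank_union_eq_iff:
  assumes "B \<subseteq> E - A"
  shows "rank_of indep (A \<union> B) = rank_of indep A \<longleftrightarrow> B \<subseteq> cl_diff A"
proof
  assume eq: "rank_of indep (A \<union> B) = rank_of indep A"
  have "rank_of indep (insert x A) = rank_of indep A" if "x \<in> B" for x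
    using that eq rank_mono[of "insert x A" "A \<union> B"] rank_mono[OF subset_insertI, of A x]
    by auto
  with assms show "B \<subseteq> cl_diff A" by (auto simp: cl_diff_def)
next
  assume sub: "B \<subseteq> cl_diff A"
  obtain I where I: "I \<subseteq> A" "indep I" "card I = rank_of indep A"
    using rank_attained by blast
  obtain J where J: "J \<subseteq> A \<union> B" "indep J" "card J = rank_of indep (A \<union> B)"
    using rank_attained by blast
  have "\<not> card I < card J"
  proof
    assume "card I < card J"
    then obtain y where y: "y \<in> J - I" "indep (insert y I)"
      using indep_augment I J by blast
    have "card (insert y I) \<le> rank_of indep (insert y A)"
      using y(2) I(1) by (intro card_le_rank) auto
    moreover have "rank_of indep (insert y A) = rank_of indep A"
      using y(1) J(1) sub by (cases "y \<in> A") (auto simp: cl_diff_def insert_absorb)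
    ultimately show False using y(1) I finite_indep[OF I(2)] by simp
  qed
  then show "rank_of indep (A \<union> B) = rank_of indep A"
    using I(3) J(3) rank_mono[of A "A \<union> B"] by simp
qed

lemma flat_iff_cl_diff: "flat E indep X \<longleftrightarrow> X \<subseteq> E \<and> cl_diff X = {}"
  using rank_mono[OF subset_insertI, of X] unfolding flat_def cl_diff_def
  by (force simp: order.strict_iff_order)

section \<open>Binomial moments read off from rank sequences\<close>

lemma sum_list_rank_sequence: "sum_list (rank_sequence indep p) = rank_of indep (set p)"
proof (induction p rule: rev_induct)
  case Nil
  then show ?case by (simp add: rank_sequence_def rank_empty)
next
  case (snoc x p)
  \<comment> \<open>The sum telescopes; monotonicity of rank makes the truncated subtraction
    exact.\<close>
  then show ?case
    using rank_mono[OF subset_insertI, of "set p" x] by (simp add: rank_sequence_snoc)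
qed

lemma take_rank_sequence: "take i (rank_sequence indep p) = rank_sequence indep (take i p)"
  unfolding rank_sequence_def take_map by (auto simp: min_def)

lemma sum_list_take_rank_sequence:
  "sum_list (take i (rank_sequence indep p)) = rank_of indep (set (take i p))"
  by (simp add: take_rank_sequence sum_list_rank_sequence)

text \<open>As entries are 0 or 1, the three partial sums force rank \<open>k\<close> at position
  \<open>s\<close>, only ones in the \<open>j\<close> places up to it and only zeros in the
  \<open>m\<close> places after it. For fixed \<open>A\<close> the second condition concerns only
  the ordering of \<open>A\<close> and the third only that of \<open>E - A\<close>, so the counts
  multiply.\<close>

lemma binomial_moment_from_rank_sequences:
  assumes "s \<le> card E" "j \<le> s" "m \<le> card E - s"
  shows "card {p \<in> permutations_of_set E.
      sum_list (take s (rank_sequence indep p)) = k \<and>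
      sum_list (take (s - j) (rank_sequence indep p)) + j = k \<and>
      sum_list (take (s + m) (rank_sequence indep p)) = k} =
    (\<Sum>A | A \<subseteq> E \<and> card A = s \<and> rank_of indep A = k.
      (num_coloops A choose j) * (card (cl_diff A) choose m)) *
    (fact j * fact (s - j) * fact m * fact (card E - s - m))"
proof -
  let ?C = "\<lambda>A. coloops A (restr indep A)"
  let ?w = "fact j * fact (s - j) * fact m * fact (card E - s - m) :: nat"
  let ?P = "\<lambda>p q. rank_of indep (set p) = k \<and> rank_of indep (set (take (s - j) p)) + j = k \<and>
    rank_of indep (set p \<union> set (take m q)) = k"
  let ?S = "\<lambda>A. {(p, q). p \<in> permutations_of_set A \<and> q \<in> permutations_of_set (E - A) \<and> ?P p q}"
  have "take (s - j) (take s p) = take (s - j) p"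
    "set (take (s + m) p) = set (take s p) \<union> set (take m (drop s p))" for p :: "'a list"
    by (simp_all add: take_add)
  then have "card {p \<in> permutations_of_set E.
      sum_list (take s (rank_sequence indep p)) = k \<and>
      sum_list (take (s - j) (rank_sequence indep p)) + j = k \<and>
      sum_list (take (s + m) (rank_sequence indep p)) = k} =
    card {p \<in> permutations_of_set E. ?P (take s p) (drop s p)}"
    by (simp only: sum_list_take_rank_sequence)
  also have "\<dots> = (\<Sum>A | A \<subseteq> E \<and> card A = s. card (?S A))"
    by (rule permutations_of_set_split[OF finite_ground assms(1)])
  \<comment> \<open>The first condition depends on \<open>A\<close> alone, so sets of another rank
    contribute nothing.\<close>
  also have "\<dots> = (\<Sum>A | A \<subseteq> E \<and> card A = s \<and> rank_of indep A = k. card (?S A))"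
  proof (intro sum.mono_neutral_right)
    show "\<forall>A\<in>{A. A \<subseteq> E \<and> card A = s} - {A. A \<subseteq> E \<and> card A = s \<and> rank_of indep A = k}.
        card (?S A) = 0"
    proof
      fix A
      assume "A \<in> {A. A \<subseteq> E \<and> card A = s} - {A. A \<subseteq> E \<and> card A = s \<and> rank_of indep A = k}"
      then have "?S A = {}" by (auto simp: permutations_of_set_def)
      then show "card (?S A) = 0" by (simp only: card.empty)
    qed
  qed (use finite_ground in auto)
  also have "\<dots> = (\<Sum>A | A \<subseteq> E \<and> card A = s \<and> rank_of indep A = k.
      (num_coloops A choose j) * (card (cl_diff A) choose m) * ?w)"
  proof (intro sum.cong refl)
    fix A assume "A \<in> {A. A \<subseteq> E \<and> card A = s \<and> rank_of indep A = k}"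
    then have A: "A \<subseteq> E" "card A = s" "rank_of indep A = k" by auto
    have fin: "finite A" using A(1) finite_ground finite_subset by blast
    \<comment> \<open>Once \<open>A\<close> has rank \<open>k\<close>, what is left separates into
      one condition on \<open>p\<close> and one on \<open>q\<close>, which makes \<open>?S A\<close>
      a product.\<close>
    have P: "?P p q \<longleftrightarrow> set (drop (card A - j) p) \<subseteq> ?C A \<and> set (take m q) \<subseteq> cl_diff A"
      if p: "p \<in> permutations_of_set A" and q: "q \<in> permutations_of_set (E - A)" for p q
    proof -
      have sp: "set p = A" "distinct p" "length p = s"
        using p A(2) by (auto simp: permutations_of_set_def distinct_card)
      let ?G = "set (take (s - j) p)"
      have "?G \<inter> set (drop (s - j) p) = {}"
        using sp(2) set_take_disj_set_drop_if_distinct by blast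
      moreover have "?G \<union> set (drop (s - j) p) = A"
        using sp(1) by (metis append_take_drop_id set_append)
      ultimately have G: "?G \<subseteq> A" "A - ?G = set (drop (s - j) p)" by auto
      have "card (A - ?G) = j"
        unfolding G(2) using sp assms(2) by (simp add: distinct_card)
      then have 1: "rank_of indep ?G + j = k \<longleftrightarrow> set (drop (s - j) p) \<subseteq> ?C A"
        using rank_drop_iff_coloops[OF fin G(1)] G(2) A(3) by simp
      have "set (take m q) \<subseteq> E - A"
        using q set_take_subset[of m q] by (auto simp: permutations_of_set_def)
      from rank_union_eq_iff[OF this] have
        2: "rank_of indep (A \<union> set (take m q)) = k \<longleftrightarrow> set (take m q) \<subseteq> cl_diff A"
        using A(3) by simp
      show ?thesis using 1 2 sp(1) A by simp
    qed
    have "?S A = {p \<in> permutations_of_set A. set (drop (card A - j) p) \<subseteq> ?C A} \<times>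
        {q \<in> permutations_of_set (E - A). set (take m q) \<subseteq> cl_diff A}"
      using P by auto
    then have "card (?S A) = card {p \<in> permutations_of_set A. set (drop (card A - j) p) \<subseteq> ?C A} *
        card {q \<in> permutations_of_set (E - A). set (take m q) \<subseteq> cl_diff A}"
      by (simp add: card_cartesian_product)
    also have "card {p \<in> permutations_of_set A. set (drop (card A - j) p) \<subseteq> ?C A} =
        (num_coloops A choose j) * fact j * fact (s - j)"
      using card_permutations_drop_subset[OF fin, of "?C A" j] A assms(2)
      by (auto simp: num_coloops_def coloops_def)
    also have "card {q \<in> permutations_of_set (E - A). set (take m q) \<subseteq> cl_diff A} =
        (card (cl_diff A) choose m) * fact m * fact (card E - s - m)"
      using card_permutations_take_subset[of "E - A" "cl_diff A" m] A fin assms(3) finite_ground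
      by (auto simp: cl_diff_def card_Diff_subset)
    finally show "card (?S A) = (num_coloops A choose j) * (card (cl_diff A) choose m) * ?w"
      by (simp add: mult_ac)
  qed
  finally show ?thesis by (simp add: sum_distrib_right)
qed

text \<open>After exchanging sums, each \<open>A\<close> contributes a product: the sum over
  \<open>j\<close> is inversion at \<open>c\<close> and selects exactly \<open>c\<close> coloops,
  and the sum over \<open>m\<close> is inversion at 0 and selects empty \<open>cl_diff A\<close>,
  that is, flats. The ranges are long enough because the coloops lie in \<open>A\<close> and
  \<open>cl_diff A\<close> lies in \<open>E - A\<close>.\<close>

lemma num_flats_binomial_moments:
  "int (num_flats E indep k s c) =
    (\<Sum>j\<le>s. \<Sum>m\<le>card E - s. (- 1) ^ (j + c) * int (j choose c) * (- 1) ^ m *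
      int (\<Sum>A | A \<subseteq> E \<and> card A = s \<and> rank_of indep A = k.
        (num_coloops A choose j) * (card (cl_diff A) choose m)))"
proof -
  let ?\<A> = "{A. A \<subseteq> E \<and> card A = s \<and> rank_of indep A = k}"
  let ?f = "\<lambda>A j. (- 1) ^ (j + c) * int (j choose c) * int (num_coloops A choose j)"
  let ?g = "\<lambda>A m. (- 1) ^ m * int (card (cl_diff A) choose m)"
  have fin: "finite ?\<A>" using finite_ground by simp
  have "(\<Sum>j\<le>s. \<Sum>m\<le>card E - s. (- 1) ^ (j + c) * int (j choose c) * (- 1) ^ m *
      int (\<Sum>A\<in>?\<A>. (num_coloops A choose j) * (card (cl_diff A) choose m))) =
    (\<Sum>j\<le>s. \<Sum>m\<le>card E - s. \<Sum>A\<in>?\<A>. ?f A j * ?g A m)"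
    by (simp add: sum_distrib_left mult_ac)
  also have "\<dots> = (\<Sum>j\<le>s. \<Sum>A\<in>?\<A>. \<Sum>m\<le>card E - s. ?f A j * ?g A m)"
    by (intro sum.cong refl sum.swap)
  also have "\<dots> = (\<Sum>A\<in>?\<A>. \<Sum>j\<le>s. \<Sum>m\<le>card E - s. ?f A j * ?g A m)"
    by (rule sum.swap)
  also have "\<dots> = (\<Sum>A\<in>?\<A>. (\<Sum>j\<le>s. ?f A j) * (\<Sum>m\<le>card E - s. ?g A m))"
    by (simp only: sum_product)
  also have "\<dots> = (\<Sum>A\<in>?\<A>. if num_coloops A = c \<and> cl_diff A = {} then 1 else 0)"
  proof (intro sum.cong refl)
    fix A assume A: "A \<in> ?\<A>"
    then have finA: "finite A" using finite_ground finite_subset by blast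
    have "num_coloops A \<le> s"
      unfolding num_coloops_def using A finA card_mono[of A] by (auto simp: coloops_def)
    then have 1: "(\<Sum>j\<le>s. ?f A j) = (if num_coloops A = c then 1 else 0)"
      by (rule binomial_inversion_delta)
    have "card (cl_diff A) \<le> card (E - A)"
      using finite_ground by (intro card_mono) (auto simp: cl_diff_def)
    also have "\<dots> = card E - s" using A finA by (auto simp: card_Diff_subset)
    finally have "(\<Sum>m\<le>card E - s. ?g A m) = (if card (cl_diff A) = 0 then 1 else 0)"
      by (rule alternating_binomial_delta)
    moreover have "finite (cl_diff A)" using finite_ground by (simp add: cl_diff_def)
    ultimately show "(\<Sum>j\<le>s. ?f A j) * (\<Sum>m\<le>card E - s. ?g A m) =
        (if num_coloops A = c \<and> cl_diff A = {} then 1 else 0)"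
      using 1 by simp
  qed
  also have "\<dots> = int (card {A \<in> ?\<A>. num_coloops A = c \<and> cl_diff A = {}})"
    using fin by (simp add: sum.If_cases Int_def)
  also have "{A \<in> ?\<A>. num_coloops A = c \<and> cl_diff A = {}} =
    {X. flat E indep X \<and> rank_of indep X = k \<and> card X = s \<and> card (coloops X (restr indep X)) = c}"
    by (auto simp: flat_iff_cl_diff num_coloops_def)
  finally show ?thesis by (simp add: num_flats_def)
qed

text \<open>This covers the sizes excluded by the assumption \<open>s \<le> card E\<close> in the
  counting of orderings.\<close>

lemma num_flats_eq_0:
  assumes "card E < s"
  shows "num_flats E indep k s c = 0"
proof -
  have "card X \<noteq> s" if "flat E indep X" for X
    using that assms card_mono[OF finite_ground, of X] by (auto simp: flat_def)
  then have "{X. flat E indep X \<and> rank_of indep X = k \<and> card X = s \<and>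
      card (coloops X (restr indep X)) = c} = {}" by blast
  then show ?thesis by (simp only: num_flats_def card.empty)
qed

end

section \<open>Comparison of two matroids with equal invariant\<close>

lemma G_invariant_determines_card:
  fixes E :: "'a set" and E' :: "'b set"
  assumes "finite E"
    and "(G_invariant E indep :: nat list \<Rightarrow>\<^sub>0 'k::field_char_0) = G_invariant E' indep'"
  shows "card E = card E'"
proof -
  have len: "length (rank_sequence ind p) = card F" if "p \<in> permutations_of_set F"
    for F :: "'c set" and ind p
    using that by (auto simp: rank_sequence_def permutations_of_set_def distinct_card)
  \<comment> \<open>The length of a rank sequence reveals the size of the ground set, and at least
    one ordering of \<open>E\<close> exists, so some ordering of \<open>E'\<close> yields a sequence
    of that length.\<close>
  have "{p \<in> permutations_of_set E. length (rank_sequence indep p) = card E} =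
      permutations_of_set E"
    using len by auto
  then have "card {p \<in> permutations_of_set E. length (rank_sequence indep p) = card E} \<noteq> 0"
    using assms(1) by simp
  then have "card {p \<in> permutations_of_set E'. length (rank_sequence indep' p) = card E} \<noteq> 0"
    using G_invariant_determines_counts[OF assms(2), of "\<lambda>r. length r = card E"] by simp
  then obtain p where "p \<in> permutations_of_set E'" "length (rank_sequence indep' p) = card E"
    by (metis (mono_tags, lifting) card.empty empty_Collect_eq)
  then show ?thesis using len by metis
qed

theorem proposition5p5:
  fixes E :: "'a set" and indep :: "'a set \<Rightarrow> bool"
    and E' :: "'b set" and indep' :: "'b set \<Rightarrow> bool"
    and k s c :: nat
  assumes "matroid E indep" and "matroid E' indep'"
    and "(G_invariant E indep :: nat list \<Rightarrow>\<^sub>0 'k::field_char_0) = G_invariant E' indep'"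
    and "k \<le> rank_of indep E"
  shows "num_flats E indep k s c = num_flats E' indep' k s c"
proof -
  interpret M: matroid E indep by fact
  interpret M': matroid E' indep' by fact
  have n: "card E = card E'"
    by (rule G_invariant_determines_card[OF M.finite_ground assms(3)])
  show ?thesis
  proof (cases "s \<le> card E")
    case False
    then show ?thesis using n M.num_flats_eq_0 M'.num_flats_eq_0 by simp
  next
    case True
    \<comment> \<open>Both moments, multiplied by their factorial factors, equal the same count of
      rank sequences. The factors agree because the ground sets have equal size, and being nonzero
      they cancel.\<close>
    have moments: "(\<Sum>A | A \<subseteq> E \<and> card A = s \<and> rank_of indep A = k.
          (M.num_coloops A choose j) * (card (M.cl_diff A) choose m)) =
        (\<Sum>A | A \<subseteq> E' \<and> card A = s \<and> rank_of indep' A = k.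
          (M'.num_coloops A choose j) * (card (M'.cl_diff A) choose m))"
      if "j \<le> s" "m \<le> card E - s" for j m
      using M.binomial_moment_from_rank_sequences[of s j m k]
        M'.binomial_moment_from_rank_sequences[of s j m k]
        G_invariant_determines_counts[OF assms(3), of "\<lambda>r. sum_list (take s r) = k \<and>
          sum_list (take (s - j) r) + j = k \<and> sum_list (take (s + m) r) = k"]
        that True n
      by simp
    have "int (num_flats E indep k s c) = int (num_flats E' indep' k s c)"
      \<comment> \<open>Both numbers are now the same integer combination of moments whose indices
        lie in the range covered by \<open>moments\<close>.\<close>
      unfolding M.num_flats_binomial_moments M'.num_flats_binomial_moments n[symmetric]
      by (intro sum.cong refl) (simp only: moments atMost_iff)
    then show ?thesis by simp
  qed
qed

end
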